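(* Let $1\le t\le h-1$ and let $i,j,n$ be nonnegative integers with $i+j\le n\le N$; if $t=1$ assume $i=0$, and if $t=h-1$ assume $j=0$. Let $f'_M\in V_{t,M}$ and $f''_M\in V_{h-t,M}$ ($M\ge 0$) be families of functions with $f'_M=0$ for $M<i$ and $f''_M=0$ for $M<j$. For $K\ge0$ define $f_K\in V_{h,K}$ by $$f_{K}(\mathbf{x})=q^{-jX_t}\,\psi_{n-i-j}(X_t,K-X_t)\,f'_{X_t}(\mathbf{x}')\,f''_{K-X_t}(\mathbf{x}''),$$ $$\psi_{n-i-j}(X_t,K-X_t)=Q_{n-i-j}\bigl(X_t-i;\,A_tq^{t+2i-1},\,A_hA_t^{-1}q^{h-t+2j-1},\,K-i-j\,|\,q\bigr),$$ when $K\ge n$, $X_t\ge i$ and $K-X_t\ge j$, and $f_K(\mathbf{x})=0$ otherwise. 1. If for all $M\ge 0$ $$\mathcal{L}'_{M+1}f'_{M+1}=q^{-i}(A_tq^{t+M+i}-1)f'_{M}\quad\text{and}\quad \mathcal{L}''_{M+1}f''_{M+1}=q^{-j}(A_hA_t^{-1}q^{h-t+M+j}-1)f''_{M},$$ then for all $K\ge 0$ $$\mathcal{L}_{K+1}f_{K+1}=q^{-n}(A_hq^{h+K+n}-1)f_{K}.$$ 2. If for all $M\ge1$ $$\mathcal{R}'_{M-1}f'_{M-1}=(q^{-M+i}-1)f'_{M}\quad\text{and}\quad \mathcal{R}''_{M-1}f''_{M-1}=(q^{-M+j}-1)f''_{M},$$ then for all $K\ge 1$ $$\mathcal{R}_{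K-1}f_{K-1}=(q^{-K+n}-1)f_{K}.$$
   Context: Let $0<q<1$, let $h\ge 2$ and $N\ge1$ be integers, and let $\alpha_1,\dots,\alpha_h$ be real numbers such that either $0<\alpha_i<q^{-1}$ for all $i$, or $\alpha_i>q^{-N}$ for all $i$. Write $(a;q)_k=\prod_{j=0}^{k-1}(1-aq^j)$. For integers $g\ge1$, $M\ge 0$, $[g;M]$ is the set of $\mathbf{x}=(x_1,\dots,x_g)$ with $x_i$ nonnegative integers and $x_1+\cdots+x_g=M$; $V_{g,M}$ is the space of complex functions on $[g;M]$. Put $X_k=x_1+\cdots+x_k$, $A_k=\alpha_1\cdots\alpha_k$, $X_0=0$, $A_0=1$. $\epsilon_j^{\pm}$ replaces $x_j$ by $x_j\pm1$; values of functions at points outside their domain are taken to be $0$. Define $\mathcal{R}_M:V_{h,M}\to V_{h,M+1}$ and $\mathcal{L}_M:V_{h,M}\to V_{h,M-1}$ by $$\mathcal{R}_Mf(\mathbf{x})=\sum_{i=1}^hq^{X_{i-1}-M-1}(1-q^{x_i})f(\epsilon_i^-(\mathbf{x})),\qquad \mathcal{L}_Mf(\mathbf{x})=\sum_{j=1}^hA_{j-1}q^{j-1+X_{j-1}}(\alpha_jq^{x_j+1}-1)f(\epsilon_j^+(\mathbf{x})).$$ For $1\le t\le h-1$ and $\mathbf{x}\in[h;K]$ write $\mathbf{x}'=(x_1,\dots,x_t)$, $\mathbf{x}''=(x_{t+1},\dots,x_h)$. $\mathcal{L}'_M,\mathcal{R}'_M$ denote the operators $\mathcal{L}_M,\mathcal{R}_M$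 defined in the same way on $V_{t,M}$ with parameters $\alpha_1,\dots,\alpha_t$ (and variables $x_1,\dots,x_t$), and $\mathcal{L}''_M,\mathcal{R}''_M$ those on $V_{h-t,M}$ with parameters $\alpha_{t+1},\dots,\alpha_h$ (and variables $x_{t+1},\dots,x_h$). For integers $0\le n\le N'$ and $0\le x\le N'$ the $q$-Hahn polynomial is $$Q_n(x;\alpha,\beta,N'|q)=q^{-nN'+n^2/2}\frac{(q;q)_{N'}}{(q;q)_{N'-n}}\sum_{k=0}^{n}\frac{(q^{-n};q)_k(\alpha\beta q^{n+1};q)_k(q^{-x};q)_k}{(\alpha q;q)_k(q^{-N'};q)_k(q;q)_k}\,q^k.$$ *)

theory Defs
  imports "HOL-Analysis.Analysis"
begin

definition qpoch :: "real \<Rightarrow> real \<Rightarrow> nat \<Rightarrow> real" where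
  "qpoch a q k = (\<Prod>j<k. 1 - a * q ^ j)"

(* The set [g;M].  The entry x_i of the mathematics is x ! (i - 1). *)
definition comps :: "nat \<Rightarrow> nat \<Rightarrow> nat list set" where
  "comps g M = {x. length x = g \<and> sum_list x = M}"

(* V_{g,M}: a function on [g;M] is represented by its extension by zero, which
   also implements the convention that values outside the domain are 0. *)
definition V :: "nat \<Rightarrow> nat \<Rightarrow> (nat list \<Rightarrow> complex) set" where
  "V g M = {f. \<forall>x. x \<notin> comps g M \<longrightarrow> f x = 0}"

abbreviation X_part :: "nat list \<Rightarrow> nat \<Rightarrow> nat" where
  "X_part x k \<equiv> sum_list (take k x)"

abbreviation A_part :: "real list \<Rightarrow> nat \<Rightarrow> real" where
  "A_part \<alpha> k \<equiv> prod_list (take k \<alpha>)"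

definition eps_plus :: "nat \<Rightarrow> nat list \<Rightarrow> nat list" where
  "eps_plus k x = x[k := x ! k + 1]"

(* Only meaningful if x ! k > 0, because of truncated subtraction. *)
definition eps_minus :: "nat \<Rightarrow> nat list \<Rightarrow> nat list" where
  "eps_minus k x = x[k := x ! k - 1]"

(* R_M : V_{g,M} \<rightarrow> V_{g,M+1}; it does not depend on the parameters \<alpha>.
   The summation index k is i - 1. *)
definition raising :: "real \<Rightarrow> nat \<Rightarrow> nat \<Rightarrow> (nat list \<Rightarrow> complex) \<Rightarrow> nat list \<Rightarrow> complex" where
  "raising q g M f = (\<lambda>x. if x \<in> comps g (M + 1) then
     (\<Sum>k<g. complex_of_real (q powi (int (X_part x k) - int M - 1) * (1 - q ^ (x ! k)))
        * (if x ! k = 0 then 0 else f (eps_minus k x)))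
     else 0)"

(* L_M : V_{g,M} \<rightarrow> V_{g,M-1} with g = length \<alpha>, where V_{g,-1} is the zero space.
   The summation index k is j - 1. *)
definition lowering :: "real \<Rightarrow> real list \<Rightarrow> nat \<Rightarrow> (nat list \<Rightarrow> complex) \<Rightarrow> nat list \<Rightarrow> complex" where
  "lowering q \<alpha> M f = (\<lambda>x. if M \<ge> 1 \<and> x \<in> comps (length \<alpha>) (M - 1) then
     (\<Sum>k<length \<alpha>. complex_of_real
        (A_part \<alpha> k * q ^ (k + X_part x k) * (\<alpha> ! k * q ^ (x ! k + 1) - 1))
        * f (eps_plus k x))
     else 0)"

(* Q_n(x; a, b, N | q), for n \<le> N and x \<le> N *)
definition q_hahn :: "nat \<Rightarrow> nat \<Rightarrow> real \<Rightarrow> real \<Rightarrow> nat \<Rightarrow> real \<Rightarrow> real" where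
  "q_hahn n x a b N q =
     q powr (- (real n * real N) + (real n)\<^sup>2 / 2) * (qpoch q q N / qpoch q q (N - n)) *
     (\<Sum>k\<le>n. (qpoch (q powi (- int n)) q k * qpoch (a * b * q ^ (n + 1)) q k * qpoch (q powi (- int x)) q k)
           / (qpoch (a * q) q k * qpoch (q powi (- int N)) q k * qpoch q q k) * q ^ k)"

(* The family f_K built from f' and f'' with x' = take t x and x'' = drop t x. *)
definition coupled ::
  "real \<Rightarrow> real list \<Rightarrow> nat \<Rightarrow> nat \<Rightarrow> nat \<Rightarrow> nat \<Rightarrow> (nat \<Rightarrow> nat list \<Rightarrow> complex) \<Rightarrow>
   (nat \<Rightarrow> nat list \<Rightarrow> complex) \<Rightarrow> nat \<Rightarrow> nat list \<Rightarrow> complex" where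
  "coupled q \<alpha> t i j n f' f'' K = (\<lambda>x.
     let h = length \<alpha>; X = X_part x t in
     if x \<in> comps h K \<and> K \<ge> n \<and> X \<ge> i \<and> K - X \<ge> j then
       complex_of_real (q powi (- (int j * int X)) *
         q_hahn (n - i - j) (X - i) (A_part \<alpha> t * q ^ (t + 2 * i - 1))
           (A_part \<alpha> h * inverse (A_part \<alpha> t) * q ^ (h - t + 2 * j - 1)) (K - i - j) q)
       * f' X (take t x) * f'' (K - X) (drop t x)
     else 0)"

lemma raising_in_V: "raising q g M f \<in> V g (M + 1)"
  by (simp add: raising_def V_def)

lemma lowering_in_V: "lowering q \<alpha> (M + 1) f \<in> V (length \<alpha>) M"
  by (simp add: lowering_def V_def)

lemma coupled_in_V: "coupled q \<alpha> t i j n f' f'' K \<in> V (length \<alpha>) K"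
  by (simp add: coupled_def V_def Let_def)

end

(* On f_K the operators L and R split into the first t and the last h - t coordinates.  The
   hypotheses on f' and f'' therefore reduce both claims to contiguous relations of the q-Hahn
   polynomials, with a = A_t q^(t+2i-1), b = A_h A_t^(-1) q^(h-t+2j-1) and 0 <= x <= M:
     (a q^(x+1) - 1) Q_m(x+1; M+1) + a q^(x+1) (b q^(M-x+1) - 1) Q_m(x; M+1)
       = q^(-m) (a b q^(M+m+2) - 1) Q_m(x; M),
     q^(x-M) (q^(-x) - 1) Q_m(x-1; M-1) + (q^(x-M) - 1) Q_m(x; M-1) = (q^(m-M) - 1) Q_m(x; M).
   The second one holds for each term of the hypergeometric sum.  In the first one, rewrite the
   k-th term of the left-hand side in the basis (q^(-x);q)_(k-1), (q^(-x);q)_k and collect the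
   coefficient of each basis element.  The range of the parameters alpha enters only to keep the
   denominators (aq;q)_k nonzero. *)

theory Submission
  imports Defs
begin

subsection \<open>Contiguous relations of q-Hahn polynomials\<close>

lemma qpoch_0 [simp]: "qpoch a q 0 = 1"
  by (simp add: qpoch_def)

lemma qpoch_Suc: "qpoch a q (Suc k) = qpoch a q k * (1 - a * q ^ k)"
  by (simp add: qpoch_def)

lemma qpoch_Suc_shift: "qpoch a q (Suc k) = (1 - a) * qpoch (a * q) q k"
  unfolding qpoch_def prod.lessThan_Suc_shift by (simp add: mult.assoc)

lemma qpoch_eq_0_iff: "qpoch a q k = 0 \<longleftrightarrow> (\<exists>j<k. a * q ^ j = 1)"
  by (auto simp: qpoch_def)

lemma qpoch_self_nonzero:
  assumes "0 < q" "q < 1"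
  shows "qpoch q q k \<noteq> 0"
proof -
  have "q * q ^ j \<noteq> 1" for j
    using power_Suc_less_one[of q j] assms by simp
  then show ?thesis by (simp add: qpoch_eq_0_iff)
qed

lemma qpoch_inverse_power_nonzero:
  assumes "0 < q" "q < 1" "k \<le> M"
  shows "qpoch (inverse (q ^ M)) q k \<noteq> 0"
proof -
  have "inverse (q ^ M) * q ^ j \<noteq> 1" if "j < k" for j
  proof -
    have "q ^ M < q ^ j"
      using that assms by (intro power_strict_decreasing) auto
    then show ?thesis
      using assms(1) by (auto simp: divide_simps)
  qed
  then show ?thesis
    by (simp add: qpoch_eq_0_iff)
qed

lemma qpoch_inverse_power_zero:
  assumes "0 < q" "x < k"
  shows "qpoch (inverse (q ^ x)) q k = 0"
  using assms by (auto simp: qpoch_eq_0_iff intro!: exI[of _ x])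

section \<open>Contiguous relations for 3phi2 series\<close>

text \<open>Summand of a 3phi2 series with free parameters. For q-Hahn polynomials \<open>u\<close>
  is q^(-x) and \<open>v\<close> is q^(-M), so lowering x or M by one multiplies \<open>u\<close> or
  \<open>v\<close> by q, and contiguous relations become rational identities in \<open>u\<close> and
  \<open>v\<close>.\<close>

definition phi_term :: "real \<Rightarrow> real \<Rightarrow> real \<Rightarrow> real \<Rightarrow> real \<Rightarrow> real \<Rightarrow> nat \<Rightarrow> real" where
  "phi_term q w c d u v k =
     qpoch w q k * qpoch c q k * qpoch u q k / (qpoch d q k * qpoch v q k * qpoch q q k) * q ^ k"

text \<open>All three terms share the factors free of u and v. Since (1 - u)(uq;q)_k = (u;q)_k (1 -
  u q^k), the left-hand side is a multiple of (u;q)_k in which v/u cancels and -(1 - v q^k) remains.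
  The same shift for v turns this into the factor v - 1.\<close>

lemma phi_term_raise:
  assumes "u \<noteq> 0" "qpoch (v * q) q k \<noteq> 0" "v \<noteq> 1" "v * q ^ k \<noteq> 1"
  shows "v / u * (u - 1) * phi_term q w c d (u * q) (v * q) k + (v / u - 1) * phi_term q w c d u (v * q) k
    = (v - 1) * phi_term q w c d u v k"
proof -
  define P where "P = qpoch w q k * qpoch c q k / (qpoch d q k * qpoch q q k) * q ^ k"
  have P: "phi_term q w c d u v k = P * (qpoch u q k / qpoch v q k)" for u v
    by (simp add: phi_term_def P_def mult_ac)
  have U: "(1 - u) * qpoch (u * q) q k = qpoch u q k * (1 - u * q ^ k)"
    by (metis qpoch_Suc qpoch_Suc_shift)
  have V: "(1 - v) * qpoch (v * q) q k = qpoch v q k * (1 - v * q ^ k)"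
    by (metis qpoch_Suc qpoch_Suc_shift)
  have V': "qpoch v q k = (1 - v) * qpoch (v * q) q k / (1 - v * q ^ k)"
    using assms by (simp add: V)
  have "v / u * (u - 1) * qpoch (u * q) q k + (v / u - 1) * qpoch u q k = - qpoch u q k * (1 - v * q ^ k)"
  proof -
    have "v / u * (u - 1) * qpoch (u * q) q k = - v / u * (qpoch u q k * (1 - u * q ^ k))"
      unfolding U[symmetric] using assms(1) by (simp add: field_simps)
    then show ?thesis
      using assms(1) by (simp only:) (simp add: field_simps)
  qed
  then have "v / u * (u - 1) * (qpoch (u * q) q k / qpoch (v * q) q k)
      + (v / u - 1) * (qpoch u q k / qpoch (v * q) q k)
      = - qpoch u q k * (1 - v * q ^ k) / qpoch (v * q) q k"
    by (metis add_divide_distrib times_divide_eq_right)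
  also have "\<dots> = (v - 1) * (qpoch u q k / qpoch v q k)"
    unfolding V' using assms by (simp add: divide_simps) (simp add: algebra_simps)
  finally have "P * (v / u * (u - 1) * (qpoch (u * q) q k / qpoch (v * q) q k)
      + (v / u - 1) * (qpoch u q k / qpoch (v * q) q k)) = P * ((v - 1) * (qpoch u q k / qpoch v q k))"
    by simp
  then show ?thesis
    unfolding P by (simp only: distrib_left mult.left_commute)
qed

text \<open>This relation does not hold term by term in general, so the partial sums are shown to
  telescope, with the last summand on the right as boundary term. Keeping \<open>w\<close>
  independent of the upper limit \<open>m\<close> makes induction on \<open>m\<close>
  possible.\<close>

lemma phi_partial_sum_lower:
  assumes "q \<noteq> 0" "u \<noteq> 0" "v \<noteq> 0" "v \<noteq> 1"
    and "qpoch (a * q) q m \<noteq> 0" "qpoch v q m \<noteq> 0" "qpoch q q m \<noteq> 0"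
  shows "(\<Sum>k\<le>m. (a / u - 1) * phi_term q w c (a * q) u v k
                + (c * w / v - a / u) * phi_term q w c (a * q) (u * q) v k)
    = (v - w) / (1 - v) * (1 - c / v) * (\<Sum>k<m. phi_term q w c (a * q) (u * q) (v * q) k)
      + (c * w / v - 1 / q ^ m) * phi_term q w c (a * q) (u * q) v m"
  using assms(5-7)
proof (induction m)
  case 0
  show ?case by (simp add: phi_term_def algebra_simps)
next
  case (Suc m)
  let ?t = "phi_term q w c (a * q)"
  define P where "P = qpoch w q m * qpoch c q m * q ^ m * qpoch (u * q) q m / (qpoch (a * q) q m * qpoch q q m)"
  have nz: "qpoch (a * q) q m \<noteq> 0" "qpoch v q m \<noteq> 0" "qpoch q q m \<noteq> 0"
    "1 - a * q * q ^ m \<noteq> 0" "1 - v * q ^ m \<noteq> 0" "1 - q * q ^ m \<noteq> 0"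
    using Suc.prems by (auto simp: qpoch_Suc)
  have V: "qpoch (v * q) q m = qpoch v q m * (1 - v * q ^ m) / (1 - v)"
    using assms(4) qpoch_Suc[of v q m] qpoch_Suc_shift[of v q m] by (simp add: field_simps)
  \<comment> \<open>Quotient of consecutive terms without its u-factor. That factor is
    \<open>1 - u\<close> for \<open>u\<close> and \<open>1 - u * q * q ^ m\<close> for
    \<open>u * q\<close>, both relative to the common (uq;q)_m inside \<open>P\<close>.\<close>
  define r where "r = (1 - w * q ^ m) * (1 - c * q ^ m) * q
      / ((1 - a * q * q ^ m) * (1 - v * q ^ m) * (1 - q * q ^ m))"
  have e1: "?t u v (Suc m) = P / qpoch v q m * r * (1 - u)"
    unfolding phi_term_def P_def r_def qpoch_Suc_shift[of u] qpoch_Suc[of w] qpoch_Suc[of c]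
      qpoch_Suc[of "a * q"] qpoch_Suc[of v] qpoch_Suc[of q]
    using nz by (simp add: field_simps)
  have e2: "?t (u * q) v (Suc m) = P / qpoch v q m * r * (1 - u * q * q ^ m)"
    unfolding phi_term_def P_def r_def qpoch_Suc
    using nz by (simp add: field_simps)
  have e3: "?t (u * q) v m = P / qpoch v q m"
    by (simp add: phi_term_def P_def mult_ac)
  have e4: "?t (u * q) (v * q) m = P / qpoch v q m * ((1 - v) / (1 - v * q ^ m))"
    unfolding phi_term_def P_def V by (simp add: mult_ac)
  define y where "y = q ^ m"
  have y: "y \<noteq> 0" using assms(1) by (simp add: y_def)
  \<comment> \<open>Splits off the new boundary term. The remainder is free of u, and its factors 1
    - qy and 1 - aqy cancel against denominators of \<open>r\<close>, so it can be expressed through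
    terms of index m.\<close>
  have coeff: "(a / u - 1) * (1 - u) + (c * w / v - a / u) * (1 - u * q * y)
     = (1 - q * y) * (1 / (q * y) - a) + (c * w / v - 1 / (q * y)) * (1 - u * q * y)"
    using assms(1-3) y by (simp add: field_simps)
  have r': "r * ((1 - q * y) * (1 / (q * y) - a)) = (1 - w * y) * (1 - c * y) / (y * (1 - v * y))"
    using nz(4-6) assms(1) y unfolding r_def y_def[symmetric] by (simp add: divide_simps)
  \<comment> \<open>Together with the old boundary weight, the remainder gives the weight of the new
    summand on the right.\<close>
  have *: "(c * w / v - 1 / y) + (1 - w * y) * (1 - c * y) / (y * (1 - v * y))
      = (v - w) * (1 - c / v) / (1 - v * y)"
    using nz(5) assms(3) y unfolding y_def[symmetric] by (simp add: field_simps)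
  have **: "(v - w) * (1 - c / v) / (1 - v * y)
      = (v - w) / (1 - v) * (1 - c / v) * ((1 - v) / (1 - v * y))"
    using assms(4) by simp
  have "(a / u - 1) * ?t u v (Suc m) + (c * w / v - a / u) * ?t (u * q) v (Suc m)
     = P / qpoch v q m * r * ((a / u - 1) * (1 - u) + (c * w / v - a / u) * (1 - u * q * y))"
    unfolding e1 e2 y_def by (simp only: distrib_left mult_ac)
  also have "\<dots> = P / qpoch v q m * (r * ((1 - q * y) * (1 / (q * y) - a)))
      + (c * w / v - 1 / (q * y)) * ?t (u * q) v (Suc m)"
    unfolding coeff unfolding e2 y_def by (simp only: distrib_left mult_ac)
  also have "P / qpoch v q m * (r * ((1 - q * y) * (1 / (q * y) - a)))
      = (v - w) / (1 - v) * (1 - c / v) * ?t (u * q) (v * q) m - (c * w / v - 1 / y) * ?t (u * q) v m"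
  proof -
    have "r * ((1 - q * y) * (1 / (q * y) - a))
      = (v - w) / (1 - v) * (1 - c / v) * ((1 - v) / (1 - v * y)) - (c * w / v - 1 / y)"
      using r' * ** by linarith
    then show ?thesis
      unfolding e3 e4 y_def by (simp only: right_diff_distrib mult_ac)
  qed
  finally show ?case
    using Suc.IH[OF nz(1-3)] by (simp add: algebra_simps y_def)
qed

text \<open>The second alternative of the last assumption covers the case \<open>v = w\<close> (degree \<open>M + 1\<close> on the
  grid \<open>{0..M}\<close>): the factor \<open>v - w\<close> is zero, and the last term on the right divides by \<open>qpoch (v * q) q m = 0\<close>.\<close>

lemma phi_sum_lower:
  assumes "q \<noteq> 0" "u \<noteq> 0" "v \<noteq> 0" "v \<noteq> 1" "w * q ^ m = 1"
    and "qpoch (a * q) q m \<noteq> 0" "qpoch v q m \<noteq> 0" "qpoch q q m \<noteq> 0"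
    and "v * q ^ m \<noteq> 1 \<or> qpoch (u * q) q m = 0"
  shows "(a / u - 1) * (\<Sum>k\<le>m. phi_term q w c (a * q) u v k)
       + (c * w / v - a / u) * (\<Sum>k\<le>m. phi_term q w c (a * q) (u * q) v k)
    = (v - w) / (1 - v) * (1 - c / v) * (\<Sum>k\<le>m. phi_term q w c (a * q) (u * q) (v * q) k)"
proof -
  let ?t = "phi_term q w c (a * q)"
  have w: "1 / q ^ m = w" using assms(1,5) by (simp add: field_simps)
  \<comment> \<open>For w = q^(-m) the boundary term is exactly the summand k = m that the partial
    sum on the right lacks. If v q^m = 1, both sides vanish because (uq;q)_m = 0.\<close>
  have "(c * w / v - 1 / q ^ m) * ?t (u * q) v m
      = (v - w) / (1 - v) * (1 - c / v) * ?t (u * q) (v * q) m"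
  proof (cases "v * q ^ m = 1")
    case True
    then show ?thesis using assms(9) by (simp add: phi_term_def)
  next
    case False
    have V: "qpoch (v * q) q m = qpoch v q m * (1 - v * q ^ m) / (1 - v)"
      using assms(4) qpoch_Suc[of v q m] qpoch_Suc_shift[of v q m] by (simp add: field_simps)
    have e: "?t (u * q) (v * q) m = ?t (u * q) v m * ((1 - v) / (1 - v * q ^ m))"
      unfolding phi_term_def V by (simp add: mult_ac)
    have "(v - w) = - w * (1 - v * q ^ m)"
      using assms(5) by (simp add: algebra_simps)
    then have "(v - w) / (1 - v) * (1 - c / v) * ((1 - v) / (1 - v * q ^ m)) = - w * (1 - c / v)"
      using False assms(4) by simp
    moreover have "(v - w) / (1 - v) * (1 - c / v) * ?t (u * q) (v * q) m
        = (v - w) / (1 - v) * (1 - c / v) * ((1 - v) / (1 - v * q ^ m)) * ?t (u * q) v m"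
      unfolding e by (simp only: mult_ac)
    ultimately show ?thesis
      unfolding w by (simp add: right_diff_distrib mult.commute)
  qed
  then show ?thesis
    using phi_partial_sum_lower[OF assms(1-4,6-8), of w c]
    by (simp add: sum.distrib sum_distrib_left[symmetric] lessThan_Suc_atMost[symmetric] distrib_left)
qed

section \<open>q-Hahn polynomials with their normalisation\<close>

definition hahn_factor :: "nat \<Rightarrow> nat \<Rightarrow> real \<Rightarrow> real" where
  "hahn_factor m M q = q powr (- (real m * real M) + (real m)\<^sup>2 / 2) * (qpoch q q M / qpoch q q (M - m))"

lemma q_hahn_eq_phi:
  "q_hahn m x a b M q = hahn_factor m M q *
     (\<Sum>k\<le>m. phi_term q (inverse (q ^ m)) (a * b * q ^ (m + 1)) (a * q) (inverse (q ^ x)) (inverse (q ^ M)) k)"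
  by (simp add: q_hahn_def hahn_factor_def phi_term_def power_int_minus)

text \<open>From M to M + 1 the exponent of q changes by -m, since m^2/2 cancels, and each factorial
  gains one factor.\<close>

lemma hahn_factor_Suc:
  assumes "0 < q" "q < 1" "m \<le> M"
  shows "(1 - q ^ (Suc M - m)) * hahn_factor m (Suc M) q = inverse (q ^ m) * (1 - q ^ Suc M) * hahn_factor m M q"
proof -
  have p: "q powr (- (real m * real (Suc M)) + (real m)\<^sup>2 / 2)
      = inverse (q ^ m) * q powr (- (real m * real M) + (real m)\<^sup>2 / 2)"
    using assms(1) by (simp add: powr_realpow[symmetric] powr_minus[symmetric] powr_add[symmetric] algebra_simps)
  have "q * q ^ (M - m) < 1"
    using power_Suc_less_one[of q "M - m"] assms by simp
  then show ?thesis
    unfolding hahn_factor_def p using assms qpoch_self_nonzero[of q "M - m"]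
    by (simp add: Suc_diff_le qpoch_Suc field_simps)
qed

text \<open>\<open>phi_term_raise\<close> summed over k. The coefficients vanish at x = 0 and x = M
  + 1 respectively, so no value off the grid {0..M} contributes.\<close>

lemma q_hahn_raise:
  assumes "0 < q" "q < 1" "m \<le> M" "x \<le> Suc M"
  shows "inverse (q ^ (Suc M - x)) * (inverse (q ^ x) - 1) * q_hahn m (x - 1) a b M q
      + (inverse (q ^ (Suc M - x)) - 1) * q_hahn m x a b M q
      = (q ^ m * inverse (q ^ Suc M) - 1) * q_hahn m x a b (Suc M) q"
proof -
  define S where "S = (\<lambda>u v. \<Sum>k\<le>m. phi_term q (inverse (q ^ m)) (a * b * q ^ (m + 1)) (a * q) u v k)"
  define u where "u = inverse (q ^ x)"
  define v where "v = inverse (q ^ Suc M)"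
  have q_hahn: "q_hahn m x a b M q = hahn_factor m M q * S (inverse (q ^ x)) (inverse (q ^ M))" for x M
    by (simp add: q_hahn_eq_phi S_def)
  have vq: "v * q = inverse (q ^ M)" and u0: "u \<noteq> 0"
    using assms(1) by (auto simp: v_def u_def)
  have vu: "inverse (q ^ (Suc M - x)) = v / u"
    using assms(1,4) by (simp add: v_def u_def power_diff field_simps)
  have "v / u * (u - 1) * S (u * q) (v * q) + (v / u - 1) * S u (v * q) = (v - 1) * S u v"
    unfolding S_def sum_distrib_left sum.distrib[symmetric]
  proof (rule sum.cong[OF refl], rule phi_term_raise)
    fix k assume "k \<in> {..m}"
    then have k: "k \<le> M" using assms(3) by simp
    show "qpoch (v * q) q k \<noteq> 0"
      unfolding vq using assms k by (intro qpoch_inverse_power_nonzero)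
    show "v \<noteq> 1" using power_Suc_less_one[of q M] assms(1,2) by (auto simp: v_def simp del: power_Suc)
    show "v * q ^ k \<noteq> 1"
      using power_strict_decreasing[of k "Suc M" q] assms k by (auto simp: v_def field_simps)
  qed (rule u0)
  \<comment> \<open>For x = 0 the truncated x - 1 does not correspond to \<open>u * q\<close>, but
    then u = 1 and both sides are zero.\<close>
  moreover have "(u - 1) * S (u * q) (v * q) = (u - 1) * S (inverse (q ^ (x - 1))) (v * q)"
  proof (cases x)
    case (Suc y)
    then have "u * q = inverse (q ^ (x - 1))"
      using assms(1) by (simp add: u_def)
    then show ?thesis by simp
  qed (simp add: u_def)
  ultimately have "v / u * (u - 1) * S (inverse (q ^ (x - 1))) (v * q) + (v / u - 1) * S u (v * q)
      = (v - 1) * S u v"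
    by (simp add: mult.assoc)
  then have "hahn_factor m M q * (v / u * (u - 1) * S (inverse (q ^ (x - 1))) (v * q) + (v / u - 1) * S u (v * q))
      = (hahn_factor m M q * (v - 1)) * S u v"
    by simp
  \<comment> \<open>The change of normalisation turns q^(-M-1) - 1 into q^(m-M-1) - 1.\<close>
  also have "hahn_factor m M q * (v - 1) = (q ^ m * v - 1) * hahn_factor m (Suc M) q"
  proof -
    have "q ^ m * q ^ (Suc M - m) = q ^ Suc M"
      using assms(3) by (simp add: power_add[symmetric])
    then have "q ^ m * v - 1 = q ^ m * v * (1 - q ^ (Suc M - m))"
      using assms(1) by (simp add: v_def field_simps)
    then have "(q ^ m * v - 1) * hahn_factor m (Suc M) q
        = q ^ m * v * ((1 - q ^ (Suc M - m)) * hahn_factor m (Suc M) q)"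
      by simp
    also have "\<dots> = hahn_factor m M q * (v - 1)"
      unfolding hahn_factor_Suc[OF assms(1-3)] using assms(1) by (simp add: v_def field_simps)
    finally show ?thesis ..
  qed
  finally show ?thesis
    unfolding q_hahn vu vq u_def[symmetric] v_def[symmetric] by (simp add: algebra_simps)
qed

text \<open>\<open>phi_sum_lower\<close> at u = q^(-x-1), v = q^(-M-1). The degree m = M + 1 is
  included because L must annihilate the coupled function f_n of the lowest level.\<close>

lemma q_hahn_lower:
  assumes "0 < q" "q < 1" "m \<le> Suc M" "x \<le> M" "qpoch (a * q) q m \<noteq> 0"
  shows "(a * q ^ (x + 1) - 1) * q_hahn m (x + 1) a b (Suc M) q
      + a * q ^ (x + 1) * (b * q ^ (M - x + 1) - 1) * q_hahn m x a b (Suc M) q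
      = (if m \<le> M then inverse (q ^ m) * (a * b * q ^ (M + m + 2) - 1) * q_hahn m x a b M q else 0)"
proof -
  define w where "w = inverse (q ^ m)"
  define c where "c = a * b * q ^ (m + 1)"
  define S where "S = (\<lambda>u v. \<Sum>k\<le>m. phi_term q w c (a * q) u v k)"
  define u where "u = inverse (q ^ (x + 1))"
  define v where "v = inverse (q ^ Suc M)"
  have q_hahn: "q_hahn m x a b M q = hahn_factor m M q * S (inverse (q ^ x)) (inverse (q ^ M))" for x M
    by (simp add: q_hahn_eq_phi S_def w_def c_def)
  have vq: "v * q = inverse (q ^ M)" and uq: "u * q = inverse (q ^ x)" and nz: "u \<noteq> 0" "v \<noteq> 0"
    using assms(1) by (auto simp: v_def u_def)
  have v1: "v \<noteq> 1" using power_Suc_less_one[of q M] assms(1,2) by (auto simp: v_def simp del: power_Suc)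
  have "(a / u - 1) * S u v + (c * w / v - a / u) * S (u * q) v
      = (v - w) / (1 - v) * (1 - c / v) * S (u * q) (v * q)"
    unfolding S_def
  proof (rule phi_sum_lower)
    show "qpoch v q m \<noteq> 0"
      unfolding v_def by (rule qpoch_inverse_power_nonzero[OF assms(1-3)])
    show "v * q ^ m \<noteq> 1 \<or> qpoch (u * q) q m = 0"
    proof (cases "m \<le> M")
      case True
      then show ?thesis
        using power_strict_decreasing[of m "Suc M" q] assms by (auto simp: v_def field_simps)
    next
      case False
      then show ?thesis
        unfolding uq using qpoch_inverse_power_zero[of q x m] assms by simp
    qed
  qed (use assms nz v1 qpoch_self_nonzero in \<open>auto simp: w_def\<close>)
  also have "a / u = a * q ^ (x + 1)"
    by (simp add: u_def field_simps)
  also have "c * w / v - a * q ^ (x + 1) = a * q ^ (x + 1) * (b * q ^ (M - x + 1) - 1)"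
  proof -
    have "q ^ (x + 1) * q ^ (M - x + 1) = q ^ (M + 2)"
      using assms(4) by (simp flip: power_add)
    then show ?thesis
      using assms(1) by (simp add: c_def w_def v_def field_simps)
  qed
  finally have eq: "hahn_factor m (Suc M) q * ((a * q ^ (x + 1) - 1) * S u v
        + a * q ^ (x + 1) * (b * q ^ (M - x + 1) - 1) * S (u * q) v)
      = hahn_factor m (Suc M) q * ((v - w) / (1 - v)) * (1 - c / v) * S (u * q) (v * q)"
    by simp
  \<comment> \<open>Here v - w = v (1 - q^(M+1-m)) supplies the factor needed by
    \<open>hahn_factor_Suc\<close>. For m = M + 1 it is zero.\<close>
  have coef: "hahn_factor m (Suc M) q * ((v - w) / (1 - v)) * (1 - c / v)
      = (if m \<le> M then inverse (q ^ m) * (a * b * q ^ (M + m + 2) - 1) * hahn_factor m M q else 0)"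
  proof (cases "m \<le> M")
    case True
    have "q ^ m * q ^ (Suc M - m) = q ^ Suc M"
      using assms(3) by (simp add: power_add[symmetric])
    then have vw: "v - w = v * (1 - q ^ (Suc M - m))"
      using assms(1) by (simp add: v_def w_def field_simps)
    have cv: "c / v = a * b * q ^ (M + m + 2)"
      using assms(1) by (simp add: c_def v_def power_add field_simps)
    have 1: "v * (1 - q ^ Suc M) = v - 1"
      using assms(1) by (simp add: v_def field_simps)
    have "hahn_factor m (Suc M) q * ((v - w) / (1 - v)) * (1 - c / v)
       = v / (1 - v) * ((1 - q ^ (Suc M - m)) * hahn_factor m (Suc M) q) * (1 - c / v)"
      by (simp add: vw)
    also have "\<dots> = (v * (1 - q ^ Suc M)) / (1 - v) * (inverse (q ^ m) * hahn_factor m M q) * (1 - c / v)"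
      unfolding hahn_factor_Suc[OF assms(1,2) True] by simp
    also have "\<dots> = inverse (q ^ m) * (c / v - 1) * hahn_factor m M q"
    proof -
      have "(v * (1 - q ^ Suc M)) / (1 - v) = -1"
        unfolding 1 using v1 by (simp add: divide_simps)
      then show ?thesis by (simp add: algebra_simps)
    qed
    finally show ?thesis using True by (simp add: cv)
  next
    case False
    then have "m = Suc M" using assms(3) by simp
    then show ?thesis by (simp add: v_def w_def)
  qed
  have "hahn_factor m (Suc M) q * ((a * q ^ (x + 1) - 1) * S u v
        + a * q ^ (x + 1) * (b * q ^ (M - x + 1) - 1) * S (u * q) v)
      = (if m \<le> M then inverse (q ^ m) * (a * b * q ^ (M + m + 2) - 1) * hahn_factor m M q else 0) * S (u * q) (v * q)"
    unfolding coef[symmetric] by (rule eq)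
  moreover have "(a * q ^ (x + 1) - 1) * (hahn_factor m (Suc M) q * S u v)
        + a * q ^ (x + 1) * (b * q ^ (M - x + 1) - 1) * (hahn_factor m (Suc M) q * S (u * q) v)
      = hahn_factor m (Suc M) q * ((a * q ^ (x + 1) - 1) * S u v
        + a * q ^ (x + 1) * (b * q ^ (M - x + 1) - 1) * S (u * q) v)"
    by (simp only: distrib_left mult_ac)
  ultimately show ?thesis
    unfolding q_hahn vq[symmetric] uq[symmetric] u_def[symmetric] v_def[symmetric]
    by (simp only: mult.assoc mult_zero_left split: if_split) simp
qed

subsection \<open>Splitting the operators\<close>

lemma eps_plus_in_comps: "k < g \<Longrightarrow> x \<in> comps g M \<Longrightarrow> eps_plus k x \<in> comps g (Suc M)"
  by (auto simp: comps_def eps_plus_def sum_list_update)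

lemma eps_minus_in_comps: "k < g \<Longrightarrow> x \<in> comps g M \<Longrightarrow> x ! k > 0 \<Longrightarrow> eps_minus k x \<in> comps g (M - 1)"
  using member_le_sum_list[of "x ! k" x]
  by (auto simp: comps_def eps_minus_def sum_list_update)

lemma take_in_comps: "x \<in> comps g M \<Longrightarrow> t \<le> g \<Longrightarrow> take t x \<in> comps t (X_part x t)"
  by (auto simp: comps_def)

lemma sum_list_drop: "sum_list (drop t x) = sum_list x - X_part x t" for x :: "nat list"
  by (metis append_take_drop_id diff_add_inverse sum_list_append)

lemma X_part_le: "X_part x t \<le> sum_list x" for x :: "nat list"
  by (metis append_take_drop_id le_add1 sum_list_append)

lemma drop_in_comps: "x \<in> comps g M \<Longrightarrow> drop t x \<in> comps (g - t) (M - X_part x t)"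
  by (auto simp: comps_def sum_list_drop)

text \<open>The product form of f_K is available on [h;K] only. This congruence, and the one for
  raising, allow it to be substituted under the operator.\<close>

lemma lowering_cong:
  assumes "\<And>x. x \<in> comps (length \<alpha>) M \<Longrightarrow> f x = g x"
  shows "lowering q \<alpha> M f = lowering q \<alpha> M g"
proof
  fix x
  have "f (eps_plus k x) = g (eps_plus k x)" if "k < length \<alpha>" "1 \<le> M" "x \<in> comps (length \<alpha>) (M - 1)" for k
    using eps_plus_in_comps[OF that(1,3)] that(2) assms by simp
  then show "lowering q \<alpha> M f x = lowering q \<alpha> M g x"
    by (auto simp: lowering_def intro!: sum.cong)
qed

lemma raising_cong:
  assumes "\<And>x. x \<in> comps h M \<Longrightarrow> f x = g x"
  shows "raising q h M f = raising q h M g"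
proof
  fix x
  have "f (eps_minus k x) = g (eps_minus k x)" if "k < h" "x \<in> comps h (M + 1)" "x ! k > 0" for k
    using eps_minus_in_comps[OF that] assms by simp
  then show "raising q h M f x = raising q h M g x"
    by (auto simp: raising_def intro!: sum.cong)
qed

lemma sum_split_at:
  fixes f :: "nat \<Rightarrow> 'a :: comm_monoid_add"
  assumes "t \<le> h"
  shows "(\<Sum>k<h. f k) = (\<Sum>k<t. f k) + (\<Sum>k<h - t. f (t + k))"
proof -
  have "(\<Sum>k<h. f k) = (\<Sum>k<t. f k) + (\<Sum>k=t..<h. f k)"
    using sum.atLeastLessThan_concat[of 0 t h f] assms by (simp add: atLeast0LessThan)
  also have "(\<Sum>k=t..<h. f k) = (\<Sum>k<h - t. f (t + k))"
    using sum.shift_bounds_nat_ivl[of f 0 t "h - t"] assms by (simp add: atLeast0LessThan add.commute)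
  finally show ?thesis .
qed

text \<open>A shift in one block leaves the other block fixed, and the scalar \<open>c\<close> sees
  only X_t. In the second block A_(t+k) = A_t A''_k and X_(t+k) = X + X''_k, which is the origin of
  the factor A_t q^(t+X).\<close>

lemma lowering_product:
  fixes f' f'' :: "nat \<Rightarrow> nat list \<Rightarrow> complex"
  assumes x: "x \<in> comps (length \<alpha>) K" and t: "t \<le> length \<alpha>"
  defines "X \<equiv> X_part x t"
  shows "lowering q \<alpha> (Suc K) (\<lambda>z. c (X_part z t) * f' (X_part z t) (take t z) * f'' (Suc K - X_part z t) (drop t z)) x
    = c (Suc X) * lowering q (take t \<alpha>) (Suc X) (f' (Suc X)) (take t x) * f'' (K - X) (drop t x)
    + of_real (A_part \<alpha> t * q ^ (t + X)) * c X * f' X (take t x)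
        * lowering q (drop t \<alpha>) (Suc (K - X)) (f'' (Suc (K - X))) (drop t x)"
    (is "lowering q \<alpha> (Suc K) ?f x = ?A + ?B")
proof -
  let ?w = "\<lambda>k. complex_of_real (A_part \<alpha> k * q ^ (k + X_part x k) * (\<alpha> ! k * q ^ (x ! k + 1) - 1))"
  have len: "length x = length \<alpha>" and sum: "sum_list x = K" using x by (auto simp: comps_def)
  have XK: "X \<le> K" using X_part_le[of t x] sum by (simp add: X_def)
  have *: "take t x \<in> comps (length (take t \<alpha>)) X" "drop t x \<in> comps (length (drop t \<alpha>)) (K - X)"
    using take_in_comps[OF x t] drop_in_comps[OF x, of t] t by (auto simp: X_def min_def)
  have 1: "(\<Sum>k<t. ?w k * ?f (eps_plus k x)) = ?A"
  proof -
    have eq: "?w k * ?f (eps_plus k x)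
      = c (Suc X) * (complex_of_real (A_part (take t \<alpha>) k * q ^ (k + X_part (take t x) k)
          * (take t \<alpha> ! k * q ^ (take t x ! k + 1) - 1)) * f' (Suc X) (eps_plus k (take t x))) * f'' (K - X) (drop t x)"
      if "k < t" for k
    proof -
      have "take t (eps_plus k x) = eps_plus k (take t x)" "drop t (eps_plus k x) = drop t x"
        using that by (auto simp: eps_plus_def take_update_swap)
      moreover have "sum_list (eps_plus k (take t x)) = Suc X"
        using that t len by (simp add: eps_plus_def sum_list_update X_def)
      ultimately show ?thesis
        using that by (simp add: min_def mult_ac)
    qed
    have low: "lowering q (take t \<alpha>) (Suc X) (f' (Suc X)) (take t x) = (\<Sum>k<t.
        complex_of_real (A_part (take t \<alpha>) k * q ^ (k + X_part (take t x) k)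
          * (take t \<alpha> ! k * q ^ (take t x ! k + 1) - 1)) * f' (Suc X) (eps_plus k (take t x)))"
      using *(1) t by (simp add: lowering_def min_def)
    show ?thesis
      unfolding low sum_distrib_left sum_distrib_right by (rule sum.cong) (simp_all only: eq lessThan_iff)
  qed
  have 2: "(\<Sum>k<length \<alpha> - t. ?w (t + k) * ?f (eps_plus (t + k) x)) = ?B"
  proof -
    have "?w (t + k) * ?f (eps_plus (t + k) x)
      = of_real (A_part \<alpha> t * q ^ (t + X)) * c X * f' X (take t x) *
        (complex_of_real (A_part (drop t \<alpha>) k * q ^ (k + X_part (drop t x) k)
          * (drop t \<alpha> ! k * q ^ (drop t x ! k + 1) - 1)) * f'' (Suc (K - X)) (eps_plus k (drop t x)))"
      if "k < length \<alpha> - t" for k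
    proof -
      have "take t (eps_plus (t + k) x) = take t x" "drop t (eps_plus (t + k) x) = eps_plus k (drop t x)"
        using that len by (auto simp: eps_plus_def drop_update_swap)
      then show ?thesis
        using that len XK t by (simp add: take_add Suc_diff_le X_def power_add mult_ac)
    qed
    moreover have "lowering q (drop t \<alpha>) (Suc (K - X)) (f'' (Suc (K - X))) (drop t x) = (\<Sum>k<length \<alpha> - t.
        complex_of_real (A_part (drop t \<alpha>) k * q ^ (k + X_part (drop t x) k)
          * (drop t \<alpha> ! k * q ^ (drop t x ! k + 1) - 1)) * f'' (Suc (K - X)) (eps_plus k (drop t x)))"
      using *(2) t by (simp add: lowering_def)
    ultimately show ?thesis
      by (simp add: sum_distrib_left)
  qed
  have "lowering q \<alpha> (Suc K) ?f x = (\<Sum>k<length \<alpha>. ?w k * ?f (eps_plus k x))"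
    using x by (simp add: lowering_def)
  also have "\<dots> = ?A + ?B"
    unfolding sum_split_at[OF t] 1 2 ..
  finally show ?thesis .
qed

text \<open>The case distinctions avoid the truncated subtractions \<open>0 - 1\<close>: the corresponding sums
  vanish termwise because all \<open>x\<^sub>k\<close> in their range are zero.\<close>

lemma raising_product:
  fixes f' f'' :: "nat \<Rightarrow> nat list \<Rightarrow> complex"
  assumes x: "x \<in> comps h K" and t: "t \<le> h" and K: "K \<ge> 1" and q: "q \<noteq> 0"
  defines "X \<equiv> X_part x t"
  shows "raising q h (K - 1) (\<lambda>z. c (X_part z t) * f' (X_part z t) (take t z) * f'' (K - 1 - X_part z t) (drop t z)) x
    = (if X = 0 then 0 else of_real (inverse (q ^ (K - X))) * c (X - 1)
        * raising q t (X - 1) (f' (X - 1)) (take t x) * f'' (K - X) (drop t x))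
    + (if X = K then 0 else c X * f' X (take t x)
        * raising q (h - t) (K - X - 1) (f'' (K - X - 1)) (drop t x))"
    (is "raising q h (K - 1) ?f x = ?A + ?B")
proof -
  let ?w = "\<lambda>x M k. complex_of_real (q powi (int (X_part x k) - int M - 1) * (1 - q ^ (x ! k)))"
  have len: "length x = h" and sum: "sum_list x = K" using x by (auto simp: comps_def)
  have XK: "X \<le> K" using X_part_le[of t x] sum by (simp add: X_def)
  have *: "take t x \<in> comps t X" "drop t x \<in> comps (h - t) (K - X)"
    using take_in_comps[OF x t] drop_in_comps[OF x, of t] t by (auto simp: X_def)
  have 1: "(\<Sum>k<t. ?w x (K - 1) k * (if x ! k = 0 then 0 else ?f (eps_minus k x))) = ?A"
  proof (cases "X = 0")
    case True
    have "x ! k = 0" if "k < t" for k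
      using True that len t unfolding X_def
      by (metis length_take min.absorb2 nth_mem nth_take sum_list_eq_0_iff)
    then show ?thesis using True by simp
  next
    case False
    have eq: "?w x (K - 1) k * (if x ! k = 0 then 0 else ?f (eps_minus k x))
      = of_real (inverse (q ^ (K - X))) * c (X - 1) * (?w (take t x) (X - 1) k
         * (if take t x ! k = 0 then 0 else f' (X - 1) (eps_minus k (take t x)))) * f'' (K - X) (drop t x)"
      if "k < t" for k
    proof (cases "x ! k = 0")
      case True then show ?thesis using that by simp
    next
      case nz: False
      have "take t (eps_minus k x) = eps_minus k (take t x)" "drop t (eps_minus k x) = drop t x"
        using that by (auto simp: eps_minus_def take_update_swap)
      moreover have "sum_list (eps_minus k (take t x)) = X - 1"
        using that t len *(1) nz eps_minus_in_comps[OF that *(1)] by (simp add: comps_def)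
      moreover have "K - 1 - (X - 1) = K - X" using False by simp
      \<comment> \<open>The raising weight depends on the total K, while the operator on the first
        block uses X instead. The discrepancy is q^(-(K-X)).\<close>
      moreover have "q powi (int (X_part x k) - int (K - 1) - 1)
          = inverse (q ^ (K - X)) * q powi (int (X_part x k) - int (X - 1) - 1)"
      proof -
        have "int (X_part x k) - int (K - 1) - 1 = - int (K - X) + (int (X_part x k) - int (X - 1) - 1)"
          using False XK by linarith
        then show ?thesis
          using q by (simp only: power_int_add simp_thms) (simp add: power_int_minus)
      qed
      ultimately show ?thesis
        using that nz by (simp add: min_def mult_ac)
    qed
    have up: "raising q t (X - 1) (f' (X - 1)) (take t x)
        = (\<Sum>k<t. ?w (take t x) (X - 1) k * (if take t x ! k = 0 then 0 else f' (X - 1) (eps_minus k (take t x))))"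
      using *(1) False by (simp add: raising_def cong: if_cong)
    show ?thesis
      unfolding up sum_distrib_left sum_distrib_right if_not_P[OF False]
      by (rule sum.cong) (simp_all only: eq lessThan_iff)
  qed
  have 2: "(\<Sum>k<h - t. ?w x (K - 1) (t + k) * (if x ! (t + k) = 0 then 0 else ?f (eps_minus (t + k) x))) = ?B"
  proof (cases "X = K")
    case True
    then have 0: "sum_list (drop t x) = 0" using *(2) by (simp add: comps_def)
    have "x ! (t + k) = 0" if "k < h - t" for k
    proof -
      have "drop t x ! k \<in> set (drop t x)" using that len by (intro nth_mem) simp
      then show ?thesis using 0 that len t by simp
    qed
    then show ?thesis using True by simp
  next
    case False
    have eq: "?w x (K - 1) (t + k) * (if x ! (t + k) = 0 then 0 else ?f (eps_minus (t + k) x))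
      = c X * f' X (take t x) * (?w (drop t x) (K - X - 1) k
         * (if drop t x ! k = 0 then 0 else f'' (K - X - 1) (eps_minus k (drop t x))))"
      if "k < h - t" for k
    proof -
      have "take t (eps_minus (t + k) x) = take t x" "drop t (eps_minus (t + k) x) = eps_minus k (drop t x)"
        using that len by (auto simp: eps_minus_def drop_update_swap)
      \<comment> \<open>In the second block X_(t+k) and K both exceed their local counterparts by X,
        so the weights agree.\<close>
      moreover have "int (X_part x (t + k)) - int (K - 1) - 1 = int (X_part (drop t x) k) - int (K - X - 1) - 1"
        using False XK by (simp add: take_add X_def)
      moreover have "drop t x ! k = x ! (t + k)" "K - 1 - X = K - X - 1"
        using that len t by simp_all
      ultimately show ?thesis by (simp add: X_def)
    qed
    have "drop t x \<in> comps (h - t) (K - X - 1 + 1)"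
      using *(2) False XK by (simp add: Suc_diff_Suc)
    then have up: "raising q (h - t) (K - X - 1) (f'' (K - X - 1)) (drop t x)
        = (\<Sum>k<h - t. ?w (drop t x) (K - X - 1) k * (if drop t x ! k = 0 then 0 else f'' (K - X - 1) (eps_minus k (drop t x))))"
      by (simp only: raising_def if_True)
    show ?thesis
      unfolding up sum_distrib_left if_not_P[OF False]
      by (rule sum.cong) (simp_all only: eq lessThan_iff)
  qed
  have "raising q h (K - 1) ?f x = (\<Sum>k<h. ?w x (K - 1) k * (if x ! k = 0 then 0 else ?f (eps_minus k x)))"
    using x unfolding raising_def le_add_diff_inverse2[OF K] by (simp only: if_True)
  also have "\<dots> = ?A + ?B"
    unfolding sum_split_at[OF t] 1 2 ..
  finally show ?thesis .
qed

subsection \<open>Coupling\<close>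

lemma A_part_Suc: "t < length \<alpha> \<Longrightarrow> A_part \<alpha> (Suc t) = A_part \<alpha> t * \<alpha> ! t"
  by (simp add: take_Suc_conv_app_nth)

lemma A_part_pos: "t \<le> length \<alpha> \<Longrightarrow> \<forall>k<t. 0 < \<alpha> ! k \<Longrightarrow> 0 < A_part \<alpha> t"
proof (induction t)
  case (Suc t)
  then show ?case by (simp add: A_part_Suc del: take_Suc)
qed simp

text \<open>Applied with r = q. The companion bound from below is applied with r = q^N.\<close>

lemma A_part_less_1:
  assumes "1 \<le> t" "t \<le> length \<alpha>" "\<forall>k<t. 0 < \<alpha> ! k \<and> \<alpha> ! k * r < 1" "0 < r"
  shows "A_part \<alpha> t * r ^ t < 1"
  using assms(1-3)
proof (induction t rule: nat_induct_at_least)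
  case base
  then show ?case by (cases \<alpha>) auto
next
  case (Suc t)
  have "0 < A_part \<alpha> t" using Suc.prems by (intro A_part_pos) auto
  then have "(A_part \<alpha> t * r ^ t) * (\<alpha> ! t * r) < 1 * 1"
    using Suc assms(4) by (intro mult_strict_mono) auto
  then show ?case
    using Suc.prems by (simp add: A_part_Suc mult_ac)
qed

lemma A_part_greater_1:
  assumes "1 \<le> t" "t \<le> length \<alpha>" "\<forall>k<t. 1 < \<alpha> ! k * r" "0 < r"
  shows "1 < A_part \<alpha> t * r ^ t"
  using assms(1-3)
proof (induction t rule: nat_induct_at_least)
  case base
  then show ?case by (cases \<alpha>) auto
next
  case (Suc t)
  have "1 * 1 < (A_part \<alpha> t * r ^ t) * (\<alpha> ! t * r)"
    using Suc assms(4) by (intro mult_strict_mono) auto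
  then show ?case
    using Suc.prems by (simp add: A_part_Suc mult_ac)
qed

text \<open>In the first range of parameters every A_t q^(t+2i+k) is below 1. In the second, A_t >
  q^(-Nt), and the exponents stay small enough to keep the product above 1.\<close>

lemma hahn_denominator_nonzero:
  fixes q :: real
  assumes q: "0 < q" "q < 1" and t: "1 \<le> t" "t \<le> length \<alpha>"
    and \<alpha>: "(\<forall>k<t. 0 < \<alpha> ! k \<and> \<alpha> ! k < inverse q) \<or> (\<forall>k<t. \<alpha> ! k > q powi (- int N))"
    and im: "i + m \<le> N" "t = 1 \<Longrightarrow> i = 0"
  shows "qpoch (A_part \<alpha> t * q ^ (t + 2 * i)) q m \<noteq> 0"
proof -
  have "A_part \<alpha> t * q ^ (t + 2 * i) * q ^ k \<noteq> 1" if k: "k < m" for k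
    using \<alpha>
  proof
    assume *: "\<forall>k<t. 0 < \<alpha> ! k \<and> \<alpha> ! k < inverse q"
    then have "A_part \<alpha> t * q ^ t < 1"
      using q t by (intro A_part_less_1) (auto simp: field_simps)
    moreover have "q ^ (2 * i + k) \<le> 1"
      using q by (simp add: power_le_one)
    moreover have "0 < A_part \<alpha> t * q ^ t"
      using q t * by (simp add: A_part_pos)
    ultimately have "A_part \<alpha> t * q ^ t * q ^ (2 * i + k) < 1"
      by (metis less_le_not_le linorder_not_less mult_left_le order_le_less_trans)
    then show ?thesis by (simp add: power_add mult_ac)
  next
    assume *: "\<forall>k<t. \<alpha> ! k > q powi (- int N)"
    then have gt: "1 < A_part \<alpha> t * (q ^ N) ^ t"
      using q t by (intro A_part_greater_1) (auto simp: power_int_minus field_simps)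
    then have "0 < A_part \<alpha> t"
      using q by (metis less_trans zero_less_one zero_less_mult_pos2 zero_less_power)
    \<comment> \<open>For t = 1 this needs i = 0. For t >= 2, i + k <= N - 1 gives 2i + k <= 2(N -
      1) <= t(N - 1).\<close>
    have "t + 2 * i + k \<le> N * t"
    proof (cases "t = 1")
      case True
      then show ?thesis using im k by simp
    next
      case False
      then have "2 \<le> t" using t by simp
      then obtain s where s: "t = s + 2" by (metis add.commute le_Suc_ex)
      obtain r where r: "N = Suc r" using im k by (cases N) auto
      show ?thesis using im k by (simp add: s r algebra_simps)
    qed
    then have "q ^ (N * t) \<le> q ^ (t + 2 * i + k)"
      using q by (intro power_decreasing) auto
    then have "1 < A_part \<alpha> t * q ^ (t + 2 * i + k)"
      using gt \<open>0 < A_part \<alpha> t\<close> by (metis mult_le_cancel_left_pos order_less_le_trans power_mult)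
    then show ?thesis by (simp add: power_add mult_ac)
  qed
  then show ?thesis by (simp add: qpoch_eq_0_iff)
qed

section \<open>Contiguous relations for the scalar factor of f_K\<close>

definition coupling_coeff :: "real \<Rightarrow> real \<Rightarrow> real \<Rightarrow> nat \<Rightarrow> nat \<Rightarrow> nat \<Rightarrow> nat \<Rightarrow> nat \<Rightarrow> real" where
  "coupling_coeff q a b i j m K X =
     q powi (- (int j * int X)) * q_hahn m (X - i) a b (K - i - j) q"

text \<open>With X = i + y and K = i + j + M this is \<open>q_hahn_lower\<close> at (y, M) times
  q^(-i-j-jX). The twist q^(-jX) gives the first term the factor q^(-j) that the second receives
  from the eigenvalue of L''.\<close>

lemma coupling_coeff_lower:
  fixes q A B :: real
  assumes q: "0 < q" "q < 1" and ts: "1 \<le> t" "1 \<le> s"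
    and X: "i \<le> X" "X + j \<le> K" and n: "n = i + j + m" "n \<le> Suc K"
    and nz: "qpoch (A * q ^ (t + 2 * i)) q m \<noteq> 0"
  defines "c \<equiv> coupling_coeff q (A * q ^ (t + 2 * i - 1)) (B * q ^ (s + 2 * j - 1)) i j m"
  shows "c (Suc K) (Suc X) * (q powi (- int i) * (A * q ^ (t + X + i) - 1))
       + A * q ^ (t + X) * c (Suc K) X * (q powi (- int j) * (B * q ^ (s + (K - X) + j) - 1))
    = (if n \<le> K then q powi (- int n) * (A * B * q ^ (t + s + K + n) - 1) * c K X else 0)"
proof -
  obtain y where y: "X = i + y" using X(1) le_Suc_ex by blast
  obtain d where d: "K = i + y + j + d" using X(2) y le_Suc_ex by blast
  define M where "M = y + d"
  define a where "a = A * q ^ (t + 2 * i - 1)"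
  define b where "b = B * q ^ (s + 2 * j - 1)"
  define H where "H = (\<lambda>y M. q_hahn m y a b M q)"
  define Z where "Z = inverse (q ^ i) * inverse (q ^ j) * inverse (q ^ (j * X))"
  \<comment> \<open>Since t and s are positive, the subtraction of 1 in the exponents of a and b is
    not truncated.\<close>
  have aq: "a * q = A * q ^ (t + 2 * i)" and bq: "b * q = B * q ^ (s + 2 * j)"
    using ts by (auto simp: a_def b_def mult.assoc simp flip: power_Suc2)
  have aq': "a * q ^ (y + 1) = A * q ^ (t + X + i)"
    unfolding power_add power_one_right mult.commute[of "q ^ y" q] mult.assoc[symmetric] aq
    by (simp add: y power_add mult_ac power2_eq_square power_mult)
  have bq': "b * q ^ (M - y + 1) = B * q ^ (s + (K - X) + j)"
    unfolding power_add power_one_right mult.commute[of _ q] mult.assoc[symmetric] bq[unfolded mult.commute[of b q]] M_def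
    by (simp add: bq y d power_add mult_ac power2_eq_square power_mult)
  have abq: "a * b * q ^ (M + m + 2) = A * B * q ^ (t + s + K + n)"
  proof -
    have "a * b * q ^ (M + m + 2) = (a * q) * (b * q) * q ^ (M + m)"
      by (simp add: power_add power2_eq_square mult_ac)
    then show ?thesis
      unfolding aq bq by (simp add: n(1) d M_def power_add mult_ac power2_eq_square power_mult)
  qed
  have "(a * q ^ (y + 1) - 1) * H (y + 1) (Suc M)
      + a * q ^ (y + 1) * (b * q ^ (M - y + 1) - 1) * H y (Suc M)
      = (if m \<le> M then inverse (q ^ m) * (a * b * q ^ (M + m + 2) - 1) * H y M else 0)"
    unfolding H_def using n nz d y
    by (intro q_hahn_lower q) (auto simp: aq M_def)
  then have main: "Z * ((A * q ^ (t + X + i) - 1) * H (y + 1) (Suc M)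
      + A * q ^ (t + X + i) * (B * q ^ (s + (K - X) + j) - 1) * H y (Suc M))
      = Z * (if m \<le> M then inverse (q ^ m) * (A * B * q ^ (t + s + K + n) - 1) * H y M else 0)"
    unfolding aq' bq' abq by simp
  have iff: "m \<le> M \<longleftrightarrow> n \<le> K" by (simp add: n(1) d M_def)
  have c: "c (Suc K) (Suc X) = inverse (q ^ (j * X)) * inverse (q ^ j) * H (y + 1) (Suc M)"
    "c (Suc K) X = inverse (q ^ (j * X)) * H y (Suc M)" "c K X = inverse (q ^ (j * X)) * H y M"
    unfolding c_def coupling_coeff_def H_def a_def[symmetric] b_def[symmetric]
    by (simp_all add: power_int_minus y d M_def power_add add_ac
        flip: of_nat_mult of_nat_add of_nat_Suc)
  have t: "A * q ^ (t + X + i) = A * q ^ (t + X) * q ^ i" by (simp add: power_add)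
  \<comment> \<open>The powers become independent letters: p = q^i, r = q^j, w = q^(jX), T = A
    q^(t+X). Only a rational identity is left.\<close>
  have expand: "inverse w * inverse r * g * (inverse p * (T * p - 1)) + T * (inverse w * g') * (inverse r * (U - 1))
      = inverse p * inverse r * inverse w * ((T * p - 1) * g + T * p * (U - 1) * g')"
    if "p \<noteq> 0" "r \<noteq> 0" "w \<noteq> 0" for w r p g g' T U :: real
    using that by (simp add: field_simps)
  show ?thesis
    unfolding c power_int_minus power_int_of_nat t
    using main q(1) by (subst expand) (simp_all add: iff Z_def t power_add n(1) mult_ac)
qed

text \<open>Reduces to \<open>q_hahn_raise\<close> at y = X - i. The twist at X - 1 contributes an
  extra q^j, which reduces the splitting factor q^(-(K-X)) to q^(-d) with d = K - X - j.\<close>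

lemma coupling_coeff_raise:
  fixes q a b :: real
  assumes q: "0 < q" "q < 1"
    and X: "i \<le> X" "X + j \<le> K" and n: "n = i + j + m" "n < K"
  defines "c \<equiv> coupling_coeff q a b i j m"
  shows "(if X = 0 then 0 else inverse (q ^ (K - X)) * c (K - 1) (X - 1) * (q powi (- int X + int i) - 1))
       + (if X = K then 0 else c (K - 1) X * (q powi (- int (K - X) + int j) - 1))
    = (q powi (- int K + int n) - 1) * c K X"
proof -
  obtain y where y: "X = i + y" using X(1) le_Suc_ex by blast
  obtain d where d: "K = i + y + j + d" using X(2) y le_Suc_ex by blast
  obtain M where M: "y + d = Suc M" using n d by (cases "y + d") auto
  define H where "H = (\<lambda>y M. q_hahn m y a b M q)"
  define Z where "Z = inverse (q ^ (j * X))"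
  have main: "inverse (q ^ d) * (inverse (q ^ y) - 1) * H (y - 1) M + (inverse (q ^ d) - 1) * H y M
      = (q ^ m * inverse (q ^ Suc M) - 1) * H y (Suc M)"
  proof -
    have "m \<le> M" "y \<le> Suc M" "Suc M - y = d"
      using n d M by auto
    then show ?thesis
      using q_hahn_raise[OF q, of m M y a b] unfolding H_def by simp
  qed
  have e: "q powi (- int X + int i) = inverse (q ^ y)" "q powi (- int (K - X) + int j) = inverse (q ^ d)"
    by (simp_all add: y d power_int_minus)
  have e3: "q powi (- int K + int n) = q ^ m * inverse (q ^ Suc M)"
  proof -
    have "- int K + int n = int m + - int (Suc M)" using M d n by simp
    then show ?thesis
      using q(1) by (simp add: power_int_diff divide_inverse del: of_nat_Suc power_Suc)
  qed
  have c1: "c (K - 1) X = Z * H y M" "c K X = Z * H y (Suc M)"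
    using M by (simp_all add: c_def coupling_coeff_def H_def Z_def power_int_minus y d flip: of_nat_mult of_nat_add)
  have first: "(if X = 0 then 0 else inverse (q ^ (K - X)) * c (K - 1) (X - 1) * (q powi (- int X + int i) - 1))
     = Z * (inverse (q ^ d) * (inverse (q ^ y) - 1) * H (y - 1) M)"
  \<comment> \<open>For y = 0 the factor q^(-y) - 1 vanishes. This covers X = 0 and also X = i > 0,
    where X - 1 falls below the range.\<close>
  proof (cases "y = 0")
    case True
    then show ?thesis unfolding e by simp
  next
    case False
    then obtain y' where y': "y = Suc y'" by (cases y) auto
    have "inverse (q ^ (K - X)) * c (K - 1) (X - 1) = Z * inverse (q ^ d) * H (y - 1) M"
      using q(1) M by (simp add: c_def coupling_coeff_def H_def Z_def power_int_minus y y' d power_add field_simps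
          flip: of_nat_mult of_nat_add)
    then show ?thesis unfolding e using False y by simp
  qed
  have second: "(if X = K then 0 else c (K - 1) X * (q powi (- int (K - X) + int j) - 1))
     = Z * ((inverse (q ^ d) - 1) * H y M)"
    unfolding e c1 by (simp add: y d)
  show ?thesis
    unfolding first second unfolding e3 c1 distrib_left[symmetric] main by (simp only: mult_ac)
qed

section \<open>The coupled family and its ladder relations\<close>

text \<open>Where X < i or K - X < j, f' or f'' is zero, whatever value the truncated scalar takes.
  So the product form required by the splitting lemmas holds on all of [h;K].\<close>

lemma coupled_eq_product:
  assumes "x \<in> comps (length \<alpha>) K" "n \<le> K"
    and "\<And>M. M < i \<Longrightarrow> f' M = (\<lambda>_. 0)" "\<And>M. M < j \<Longrightarrow> f'' M = (\<lambda>_. 0)"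
  shows "coupled q \<alpha> t i j n f' f'' K x =
    of_real (coupling_coeff q (A_part \<alpha> t * q ^ (t + 2 * i - 1))
      (A_part \<alpha> (length \<alpha>) * inverse (A_part \<alpha> t) * q ^ (length \<alpha> - t + 2 * j - 1)) i j (n - i - j) K (X_part x t))
    * f' (X_part x t) (take t x) * f'' (K - X_part x t) (drop t x)"
  using assms unfolding coupled_def coupling_coeff_def Let_def
  by (cases "X_part x t < i"; cases "K - X_part x t < j") auto

lemma coupled_eq_0: "x \<notin> comps (length \<alpha>) K \<or> K < n \<Longrightarrow> coupled q \<alpha> t i j n f' f'' K x = 0"
  by (auto simp: coupled_def Let_def)

lemma lowering_eq_0: "x \<notin> comps (length \<alpha>) M \<Longrightarrow> lowering q \<alpha> (M + 1) f x = 0"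
  by (simp add: lowering_def)

lemma raising_eq_0: "x \<notin> comps g (M + 1) \<Longrightarrow> raising q g M f x = 0"
  by (simp add: raising_def)

theorem theorem4p3:
  fixes q :: real and h N t i j n :: nat and \<alpha> :: "real list"
    and f' f'' :: "nat \<Rightarrow> nat list \<Rightarrow> complex"
  assumes "0 < q" "q < 1"
    and "h \<ge> 2" and "N \<ge> 1"
    and "length \<alpha> = h"
    and "(\<forall>k<h. 0 < \<alpha> ! k \<and> \<alpha> ! k < inverse q) \<or> (\<forall>k<h. \<alpha> ! k > q powi (- int N))"
    and "1 \<le> t" and "t \<le> h - 1"
    and "i + j \<le> n" and "n \<le> N"
    and "t = 1 \<Longrightarrow> i = 0" and "t = h - 1 \<Longrightarrow> j = 0"
    and "\<And>M. f' M \<in> V t M" and "\<And>M. f'' M \<in> V (h - t) M"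
    and "\<And>M. M < i \<Longrightarrow> f' M = (\<lambda>_. 0)" and "\<And>M. M < j \<Longrightarrow> f'' M = (\<lambda>_. 0)"
  defines "f \<equiv> coupled q \<alpha> t i j n f' f''"
  shows
    "((\<forall>M. lowering q (take t \<alpha>) (M + 1) (f' (M + 1)) =
            (\<lambda>x. complex_of_real (q powi (- int i) * (A_part \<alpha> t * q ^ (t + M + i) - 1)) * f' M x)) \<and>
      (\<forall>M. lowering q (drop t \<alpha>) (M + 1) (f'' (M + 1)) =
            (\<lambda>x. complex_of_real (q powi (- int j) *
              (A_part \<alpha> h * inverse (A_part \<alpha> t) * q ^ (h - t + M + j) - 1)) * f'' M x))
      \<longrightarrow> (\<forall>K. lowering q \<alpha> (K + 1) (f (K + 1)) =
            (\<lambda>x. complex_of_real (q powi (- int n) * (A_part \<alpha> h * q ^ (h + K + n) - 1)) * f K x)))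
     \<and>
     ((\<forall>M\<ge>1. raising q t (M - 1) (f' (M - 1)) =
            (\<lambda>x. complex_of_real (q powi (- int M + int i) - 1) * f' M x)) \<and>
      (\<forall>M\<ge>1. raising q (h - t) (M - 1) (f'' (M - 1)) =
            (\<lambda>x. complex_of_real (q powi (- int M + int j) - 1) * f'' M x))
      \<longrightarrow> (\<forall>K\<ge>1. raising q h (K - 1) (f (K - 1)) =
            (\<lambda>x. complex_of_real (q powi (- int K + int n) - 1) * f K x)))"
proof -
  note q = assms(1,2) and len = assms(5) and zero = assms(15,16)
  define m where "m = n - i - j"
  define A where "A = A_part \<alpha> t"
  define B where "B = A_part \<alpha> h * inverse A"
  define c where "c = coupling_coeff q (A * q ^ (t + 2 * i - 1)) (B * q ^ (h - t + 2 * j - 1)) i j m"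
  have n: "n = i + j + m" and t: "t \<le> length \<alpha>" "t < h"
    using assms by (auto simp: m_def)
  have nz: "qpoch (A * q ^ (t + 2 * i)) q m \<noteq> 0"
    unfolding A_def using assms n t by (intro hahn_denominator_nonzero[where N = N]) auto
  have "0 < q powi (- int N)" using q by simp
  \<comment> \<open>Both ranges force positive parameters, so A_t cancels in A * B.\<close>
  then have "\<forall>k<h. 0 < \<alpha> ! k" using assms(6) by force
  then have "0 < A" unfolding A_def using t by (intro A_part_pos) auto
  then have AB: "A * B = A_part \<alpha> h" by (simp add: B_def)
  have f_eq: "f K x = of_real (c K (X_part x t)) * f' (X_part x t) (take t x) * f'' (K - X_part x t) (drop t x)"
    if "x \<in> comps h K" "n \<le> K" for K x
    using coupled_eq_product[of x \<alpha> K n i f' j f'' q t] that zero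
    unfolding f_def c_def A_def[symmetric] len B_def[symmetric] m_def[symmetric] by simp
  have f_0: "f K x = 0" if "x \<notin> comps h K \<or> K < n" for K x
    using coupled_eq_0 that unfolding f_def len[symmetric] by blast
  have lower: "lowering q \<alpha> (K + 1) (f (K + 1)) x
      = complex_of_real (q powi (- int n) * (A_part \<alpha> h * q ^ (h + K + n) - 1)) * f K x"
    if L': "\<And>M. lowering q (take t \<alpha>) (M + 1) (f' (M + 1)) =
            (\<lambda>x. complex_of_real (q powi (- int i) * (A * q ^ (t + M + i) - 1)) * f' M x)"
      and L'': "\<And>M. lowering q (drop t \<alpha>) (M + 1) (f'' (M + 1)) =
            (\<lambda>x. complex_of_real (q powi (- int j) * (B * q ^ (h - t + M + j) - 1)) * f'' M x)"
    for K x
  \<comment> \<open>The level K = n - 1 belongs to the main case: f_K is zero there, but f_(K+1)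
    need not be.\<close>
  proof (cases "x \<in> comps h K \<and> n \<le> Suc K")
    case False
    have "lowering q \<alpha> (K + 1) (f (K + 1)) x = 0"
    proof (cases "x \<in> comps h K")
      case True
      then have "f (K + 1) = (\<lambda>_. 0)"
        using False by (intro ext f_0 disjI2) auto
      then show ?thesis by (simp add: lowering_def)
    qed (use lowering_eq_0[of x \<alpha> K] len in simp)
    then show ?thesis using False f_0 by (cases "x \<in> comps h K") auto
  next
    case True
    define X where "X = X_part x t"
    define F where "F = f' X (take t x) * f'' (K - X) (drop t x)"
    have XK: "X \<le> K" using X_part_le[of t x] True by (simp add: X_def comps_def)
    have "lowering q \<alpha> (Suc K) (f (Suc K)) x = lowering q \<alpha> (Suc K)
        (\<lambda>z. of_real (c (Suc K) (X_part z t)) * f' (X_part z t) (take t z) * f'' (Suc K - X_part z t) (drop t z)) x"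
      by (rule fun_cong[OF lowering_cong], rule f_eq) (use True len in auto)
    also have "\<dots> = complex_of_real (c (Suc K) (Suc X) * (q powi (- int i) * (A * q ^ (t + X + i) - 1))
       + A * q ^ (t + X) * c (Suc K) X * (q powi (- int j) * (B * q ^ (h - t + (K - X) + j) - 1))) * F"
    proof -
      have "x \<in> comps (length \<alpha>) K" using True len by simp
      note product = lowering_product[OF this t(1), of q "\<lambda>X. of_real (c (Suc K) X)" f' f'']
      show ?thesis
        unfolding product X_def[symmetric] A_def[symmetric] F_def
          L'[unfolded Suc_eq_plus1[symmetric]] L''[unfolded Suc_eq_plus1[symmetric]]
        by (simp only: of_real_add of_real_mult distrib_left distrib_right mult_ac)
    qed
    also have "\<dots> = complex_of_real (q powi (- int n) * (A_part \<alpha> h * q ^ (h + K + n) - 1)) * f K x"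
    \<comment> \<open>Outside this range both sides vanish, because f' or f'' does.\<close>
    proof (cases "i \<le> X \<and> X + j \<le> K")
      case False
      then have "X < i \<or> K - X < j" using XK by linarith
      then have "F = 0" using zero by (auto simp: F_def)
      moreover have "f K x = 0"
        using f_eq[of x K] f_0[of x K] True calculation by (cases "n \<le> K") (auto simp: F_def X_def)
      ultimately show ?thesis by simp
    next
      case X: True
      have th: "t + (h - t) = h" using t by simp
      have "1 \<le> h - t" using t by simp
      note coeff = coupling_coeff_lower[OF q \<open>1 \<le> t\<close> this conjunct1[OF X] conjunct2[OF X] n conjunct2[OF True] nz,
          of B, folded c_def, unfolded th AB]
      show ?thesis
      proof (cases "n \<le> K")
        case n_le: True
        have "f K x = of_real (c K X) * F"
          using f_eq[of x K] True n_le by (simp add: F_def X_def)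
        then show ?thesis
          unfolding coeff if_P[OF n_le] by (simp only: of_real_mult mult.assoc)
      next
        case False
        then show ?thesis
          unfolding coeff if_not_P[OF False] using f_0[of x K] by simp
      qed
    qed
    finally show ?thesis by simp
  qed
  have raise: "raising q h (K - 1) (f (K - 1)) x = complex_of_real (q powi (- int K + int n) - 1) * f K x"
    if R': "\<And>M. M \<ge> 1 \<Longrightarrow> raising q t (M - 1) (f' (M - 1)) =
            (\<lambda>x. complex_of_real (q powi (- int M + int i) - 1) * f' M x)"
      and R'': "\<And>M. M \<ge> 1 \<Longrightarrow> raising q (h - t) (M - 1) (f'' (M - 1)) =
            (\<lambda>x. complex_of_real (q powi (- int M + int j) - 1) * f'' M x)"
      and K: "K \<ge> 1"
    for K x
  \<comment> \<open>For K <= n the function f_(K-1) is zero. On the right f_K = 0 if K < n, and the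
    eigenvalue q^0 - 1 is zero if K = n.\<close>
  proof (cases "x \<in> comps h K \<and> n < K")
    case False
    have "raising q h (K - 1) (f (K - 1)) x = 0"
    proof (cases "x \<in> comps h K")
      case True
      then have "f (K - 1) = (\<lambda>_. 0)"
        using False K by (intro ext f_0 disjI2) auto
      then show ?thesis by (simp add: raising_def)
    qed (use K in \<open>simp add: raising_eq_0\<close>)
    moreover have "q powi (- int K + int n) - 1 = 0 \<or> f K x = 0"
      using False f_0 by (cases "K = n") auto
    ultimately show ?thesis by (metis mult_eq_0_iff of_real_0)
  next
    case True
    define X where "X = X_part x t"
    define F where "F = f' X (take t x) * f'' (K - X) (drop t x)"
    have XK: "X \<le> K" using X_part_le[of t x] True by (simp add: X_def comps_def)
    have "raising q h (K - 1) (f (K - 1)) x = raising q h (K - 1)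
        (\<lambda>z. of_real (c (K - 1) (X_part z t)) * f' (X_part z t) (take t z) * f'' (K - 1 - X_part z t) (drop t z)) x"
      by (rule fun_cong[OF raising_cong], rule f_eq) (use True in auto)
    also have "\<dots> = (if X = 0 then 0 else of_real (inverse (q ^ (K - X))) * of_real (c (K - 1) (X - 1))
        * raising q t (X - 1) (f' (X - 1)) (take t x) * f'' (K - X) (drop t x))
      + (if X = K then 0 else of_real (c (K - 1) X) * f' X (take t x)
        * raising q (h - t) (K - X - 1) (f'' (K - X - 1)) (drop t x))"
      unfolding X_def using True t K q by (intro raising_product) auto
    also have "\<dots> = complex_of_real
        ((if X = 0 then 0 else inverse (q ^ (K - X)) * c (K - 1) (X - 1) * (q powi (- int X + int i) - 1))
       + (if X = K then 0 else c (K - 1) X * (q powi (- int (K - X) + int j) - 1))) * F"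
      (is "?U + ?W = of_real (?u + ?w) * F")
    proof -
      \<comment> \<open>The block hypotheses require level at least 1. At X = 0 or X = K the
        corresponding summands on both sides are zero by the case distinctions.\<close>
      have "?U = of_real ?u * F"
        using R'[of X] by (cases "X = 0") (simp_all add: F_def)
      moreover have "?W = of_real ?w * F"
        using R''[of "K - X"] XK by (cases "X = K") (simp_all add: F_def)
      ultimately show ?thesis by (simp only: of_real_add distrib_right)
    qed
    also have "\<dots> = complex_of_real (q powi (- int K + int n) - 1) * f K x"
    proof (cases "i \<le> X \<and> X + j \<le> K")
      case False
      then have "X < i \<or> K - X < j" using XK by linarith
      then have "F = 0" using zero by (auto simp: F_def)
      moreover have "f K x = 0"
        using f_eq[of x K] True calculation by (auto simp: F_def X_def)
      ultimately show ?thesis by simp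
    next
      case X: True
      have "f K x = of_real (c K X) * F"
        using f_eq[of x K] True by (simp add: F_def X_def)
      then show ?thesis
        unfolding coupling_coeff_raise[OF q conjunct1[OF X] conjunct2[OF X] n conjunct2[OF True],
            of "A * q ^ (t + 2 * i - 1)" "B * q ^ (h - t + 2 * j - 1)", folded c_def]
        by (simp only: of_real_mult mult.assoc)
    qed
    finally show ?thesis .
  qed
  show ?thesis
  proof (intro conjI impI allI ext, goal_cases)
    case (1 K x)
    then show ?case
      by (intro lower) (simp_all only: A_def B_def)
  next
    case (2 K x)
    then show ?case
      by (intro raise) simp_all
  qed
qed

end
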